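(* Let $n>1$ be an integer and let $a,b\in GP(\mathbb Z_n)$ be such that $a-1,b-1\in GP(\mathbb Z_n)$. Then the meet $a\wedge b$ exists in the poset $(\mathbb Z_n,\leq)$, and $a\wedge b\in GP(\mathbb Z_n)$.
   Context: On $\mathbb Z_n$ define the partial order $\leq$ by: $a\leq b$ iff $a=b$ or $a\equiv ab\pmod n$. $GP(\mathbb Z_n)$ is the set of $a\in\mathbb Z_n$ with $a^m=a$ for some integer $m\geq2$. *)

theory Defs
  imports "HOL-Number_Theory.Residues" "HOL-Algebra.Lattice"
begin

definition GP :: "int \<Rightarrow> int set" where
  "GP n = {a \<in> carrier (residue_ring n). \<exists>m::nat. m \<ge> 2 \<and> a [^]\<^bsub>residue_ring n\<^esub> m = a}"

definition Zn_poset :: "int \<Rightarrow> int gorder" where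
  "Zn_poset n =
     \<lparr>carrier = carrier (residue_ring n),
      eq = (=),
      le = (\<lambda>a b. a = b \<or> [a = a * b] (mod n))\<rparr>"

lemma partial_order_Zn_poset: "partial_order (Zn_poset n)"
proof -
  have anti: "x = y"
    if "[x = x * y] (mod n)" "[y = y * x] (mod n)" "x \<in> {0..n - 1}" "y \<in> {0..n - 1}" for x y
  proof -
    have "[x = y] (mod n)"
      using that(1,2) by (simp add: cong_def mult.commute)
    then show ?thesis
      using that(3,4) by (simp add: cong_def)
  qed
  have trans: "[x = x * z] (mod n)" if "[x = x * y] (mod n)" "[y = y * z] (mod n)" for x y z
  proof -
    have "[x = x * (y * z)] (mod n)"
      using that by (meson cong_scalar_left cong_trans)
    moreover have "[x * (y * z) = x * z] (mod n)"
      using cong_scalar_right[OF that(1), of z] by (simp add: cong_sym mult.assoc)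
    ultimately show ?thesis
      by (rule cong_trans)
  qed
  show ?thesis
    by unfold_locales
      (auto simp: Zn_poset_def residue_ring_def intro: anti dest: trans)
qed

end

theory Submission
  imports Defs
begin

text \<open>
  Put u = a - 1 and u ^ (k + 1) = u with k \<ge> 1. Then e = 1 - u ^ k is an idempotent generating the
  annihilator of u, so c = c * a iff c = c * e; likewise f for b. If a and b are comparable, the
  smaller one is the meet. Otherwise the lower bounds of a and b are the c with c = c * (e * f),
  and the greatest of them is the idempotent e * f.
\<close>

lemma ex_idempotent_same_fixed_points:
  fixes n a :: int
  assumes "m \<ge> 2" "[(a - 1) ^ m = a - 1] (mod n)"
  obtains e where "[e * e = e] (mod n)"
    and "\<And>c. [c = c * e] (mod n) \<longleftrightarrow> [c = c * a] (mod n)"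
proof -
  define u where "u = a - 1"
  \<comment> \<open>The exponent k of the overview is \<open>Suc j\<close>; being positive, it
    leaves a factor \<open>u\<close> in u^k, with \<open>u ^ j\<close> as cofactor.\<close>
  obtain j where m: "m = Suc (Suc j)"
    using assms(1) by (metis Suc_le_D numeral_2_eq_2 Suc_le_mono)
  have u: "n dvd u ^ Suc (Suc j) - u"
    using assms(2) by (simp add: m u_def cong_iff_dvd_diff)
  show thesis
  proof
    define e where "e = 1 - u ^ Suc j"
    have "e * e - e = u ^ j * (u ^ Suc (Suc j) - u)"
      by (simp add: e_def algebra_simps)
    then show "[e * e = e] (mod n)"
      using u by (simp add: cong_iff_dvd_diff)
    fix c
    have "c - c * e = c * u * u ^ j"
      by (simp add: e_def algebra_simps)
    \<comment> \<open>The previous identity shows that \<open>c * u = 0\<close> mod \<open>n\<close>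
      forces \<open>c = c * e\<close>. This one gives the converse, since its last term vanishes mod
      \<open>n\<close> by \<open>u\<close>.\<close>
    moreover have "c * u = u * (c - c * e) - c * (u ^ Suc (Suc j) - u)"
      by (simp add: e_def algebra_simps)
    ultimately have "n dvd c - c * e \<longleftrightarrow> n dvd c * u"
      by (metis u dvd_diff dvd_mult dvd_mult2)
    also have "\<dots> \<longleftrightarrow> n dvd c - c * a"
      by (metis dvd_minus_iff minus_diff_eq mult.right_neutral right_diff_distrib u_def)
    finally show "[c = c * e] (mod n) \<longleftrightarrow> [c = c * a] (mod n)"
      by (simp add: cong_iff_dvd_diff)
  qed
qed

text \<open>Forward, multiplying \<open>c = c * (e * f)\<close> by \<open>e\<close> or by
  \<open>f\<close> leaves the right-hand side unchanged by idempotence. Backward, substitute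
  \<open>c = c * e\<close> into \<open>c = c * f\<close>.\<close>

lemma cong_mult_idempotents_iff:
  fixes c e f n :: int
  assumes "[e * e = e] (mod n)" "[f * f = f] (mod n)"
  shows "[c = c * (e * f)] (mod n) \<longleftrightarrow> [c = c * e] (mod n) \<and> [c = c * f] (mod n)"
proof
  assume c: "[c = c * (e * f)] (mod n)"
  have "[c * (e * f) * e = c * (e * f)] (mod n)"
    using cong_scalar_left[OF assms(1), of "c * f"] by (simp add: ac_simps)
  moreover have "[c * (e * f) * f = c * (e * f)] (mod n)"
    using cong_scalar_left[OF assms(2), of "c * e"] by (simp add: ac_simps)
  ultimately show "[c = c * e] (mod n) \<and> [c = c * f] (mod n)"
    using c by (meson cong_scalar_right cong_sym cong_trans)
next
  assume "[c = c * e] (mod n) \<and> [c = c * f] (mod n)"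
  then show "[c = c * (e * f)] (mod n)"
    by (metis cong_scalar_right cong_trans mult.assoc)
qed

lemma GP_iff:
  assumes "n > 1"
  shows "a \<in> GP n \<longleftrightarrow> a \<in> {0..<n} \<and> (\<exists>m\<ge>2. [a ^ m = a] (mod n))"
proof -
  interpret residues n "residue_ring n"
    by unfold_locales (use assms in auto)
  have "a [^]\<^bsub>residue_ring n\<^esub> (m::nat) = a ^ m mod n" if "a \<in> {0..<n}" for m
    using pow_cong[of a m] that by simp
  then show ?thesis
    by (auto simp: GP_def res_carrier_eq cong_def)
qed

lemma idempotent_mod_in_GP:
  assumes "n > 1" "[e * e = e] (mod n)"
  shows "e mod n \<in> GP n"
proof -
  have "[(e mod n) ^ 2 = e mod n] (mod n)"
    using assms(2) by (simp add: power2_eq_square cong_def mod_mult_eq)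
  then show ?thesis
    using assms(1) by (auto simp: GP_iff)
qed

lemma residue_minus_one_eq:
  assumes "n > 1" "a \<in> {0..<n}"
  shows "a \<ominus>\<^bsub>residue_ring n\<^esub> \<one>\<^bsub>residue_ring n\<^esub> = (a - 1) mod n"
proof -
  interpret residues n "residue_ring n"
    by unfold_locales (use assms in auto)
  show ?thesis
    using assms by (simp add: a_minus_def res_neg_eq res_add_eq res_one_eq mod_simps)
qed

text \<open>The meet is a Hilbert choice among greatest lower bounds, and antisymmetry leaves only
  one candidate.\<close>

lemma (in partial_order) meet_eq_glb:
  assumes "is_glb L c {a, b}"
  shows "a \<sqinter> b = c"
  using assms unfolding meet_def inf_def
  by (metis (mono_tags, lifting) greatest_unique someI)

lemma is_glb_Zn_poset_if_le:
  assumes "a \<in> {0..<n}" "b \<in> {0..<n}" "a = b \<or> [a = a * b] (mod n)"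
  shows "is_glb (Zn_poset n) a {a, b}"
  using assms by (auto simp: greatest_def Lower_def Zn_poset_def residue_ring_def)

theorem theorem3p10:
  fixes n a b :: int
  assumes "n > 1"
    and "a \<in> GP n" and "b \<in> GP n"
    and "a \<ominus>\<^bsub>residue_ring n\<^esub> \<one>\<^bsub>residue_ring n\<^esub> \<in> GP n"
    and "b \<ominus>\<^bsub>residue_ring n\<^esub> \<one>\<^bsub>residue_ring n\<^esub> \<in> GP n"
  shows "(\<exists>c. is_glb (Zn_poset n) c {a, b}) \<and>
         a \<sqinter>\<^bsub>Zn_poset n\<^esub> b \<in> GP n"
proof -
  have ran: "a \<in> {0..<n}" "b \<in> {0..<n}"
    using assms(1-3) by (auto simp: GP_iff)
  have pow: "\<exists>m\<ge>2. [(x - 1) ^ m = x - 1] (mod n)"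
    if "x \<in> {0..<n}" "x \<ominus>\<^bsub>residue_ring n\<^esub> \<one>\<^bsub>residue_ring n\<^esub> \<in> GP n" for x
    using that assms(1) by (auto simp: residue_minus_one_eq GP_iff cong_def power_mod)
  have "\<exists>c \<in> GP n. is_glb (Zn_poset n) c {a, b}"
  \<comment> \<open>The split is due to the reflexive clause of the order: a non-idempotent
    \<open>a\<close> lies below itself although \<open>[a = a * a] (mod n)\<close> fails. If
    \<open>a\<close> and \<open>b\<close> are incomparable, a common lower bound equals neither of
    them, so both of its relations are congruences.\<close>
  proof (cases "a = b \<or> [a = a * b] (mod n) \<or> [b = b * a] (mod n)")
    case True
    then show ?thesis
      using is_glb_Zn_poset_if_le[of a n b] is_glb_Zn_poset_if_le[of b n a] ran assms(2,3)
      by (metis insert_commute)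
  next
    case False
    obtain e where e: "[e * e = e] (mod n)"
        "\<And>c. [c = c * e] (mod n) \<longleftrightarrow> [c = c * a] (mod n)"
      using pow[OF ran(1) assms(4)] ex_idempotent_same_fixed_points by blast
    obtain f where f: "[f * f = f] (mod n)"
        "\<And>c. [c = c * f] (mod n) \<longleftrightarrow> [c = c * b] (mod n)"
      using pow[OF ran(2) assms(5)] ex_idempotent_same_fixed_points by blast
    \<comment> \<open>The reduction puts the idempotent into the carrier.\<close>
    define g where "g = e * f mod n"
    have idem: "[e * f * (e * f) = e * f] (mod n)"
      using cong_mult[OF e(1) f(1)] by (simp add: ac_simps)
    then have GP: "g \<in> GP n"
      unfolding g_def by (rule idempotent_mod_in_GP[OF assms(1)])
    have below: "[c = c * g] (mod n) \<longleftrightarrow> [c = c * a] (mod n) \<and> [c = c * b] (mod n)" for c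
      using cong_mult_idempotents_iff[OF e(1) f(1), of c] e(2) f(2)
      by (simp add: g_def cong_def mod_mult_right_eq)
    \<comment> \<open>With \<open>c = g\<close> in \<open>below\<close>, this makes \<open>g\<close>
      itself a lower bound. Maximality is the other direction of \<open>below\<close>, as any common
      lower bound \<open>c\<close> satisfies \<open>[c = c * g] (mod n)\<close>.\<close>
    have "[g = g * g] (mod n)"
      using idem by (simp add: g_def cong_def mod_mult_eq)
    then have "is_glb (Zn_poset n) g {a, b}"
      using GP False below ran assms(1)
      by (auto simp: greatest_def Lower_def Zn_poset_def residue_ring_def GP_iff)
    then show ?thesis
      using GP by blast
  qed
  then show ?thesis
    using partial_order.meet_eq_glb[OF partial_order_Zn_poset] by metis
qed

end
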